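(* Let $(X,\cdot)$ be a right P{\l}onka magma. (1) The P{\l}onka partition of $(X,\cdot)$ whose parts $X_i$ are the equivalence classes of the relation $$a\approx b\iff x\cdot a=x\cdot b\ \text{ for all } x\in X,$$ with $f_i^j(x_i)=x_i\cdot x_j$ for $x_i\in X_i$, $x_j\in X_j$, is the coarsest P{\l}onka partition of $(X,\cdot)$ (i.e. it satisfies $\mathcal{X}\preceq\mathcal{Y}$ for every P{\l}onka partition $\mathcal{Y}$), and it is the unique coarsest one. (2) There is also a finest P{\l}onka partition (i.e. one satisfying $\mathcal{X}\succeq\mathcal{Y}$ for every P{\l}onka partition $\mathcal{Y}$), and it is uniquely characterized as the P{\l}onka partition $(X_i,f_i^j)$ for which the families $$\mathcal{F}_i=\{f_i^j:X_i\to X_i\}_{j\in I},\qquad i\in I,$$ are all connected.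
   Context: A right P{\l}onka magma is a set $X$ with a binary operation such that $(x\cdot y)\cdot z=(x\cdot z)\cdot y$ and $x\cdot(y\cdot z)=x\cdot y$ for all $x,y,z\in X$. A P{\l}onka partition of a right P{\l}onka magma $(X,\cdot)$ is a structure $(X_i,f_i^j)$ consisting of a partition $X=\coprod_{i\in I}X_i$ into non-empty parts and functions $f_i^j:X_i\to X_i$ ($i,j\in I$) with $f_i^j\circ f_i^k=f_i^k\circ f_i^j$ for all $i,j,k\in I$ and $x_i\cdot x_j=f_i^j(x_i)$ for all $x_i\in X_i$, $x_j\in X_j$. (Partitions differing only by a relabelling of the index set are identified.) Given two P{\l}onka partitions $\mathcal{X}=(X_i,f_i^j)$ and $\mathcal{Y}=(Y_\alpha,f_\alpha^\beta)$ of $(X,\cdot)$, $\mathcal{X}$ is coarser than $\mathcal{Y}$, equivalently $\mathcal{Y}$ is finer than $\mathcal{X}$ (written $\mathcal{X}\preceq\mathcal{Y}$ or $\mathcal{Y}\succeq\mathcal{X}$), if every $Y_\alpha$ is contained in some $X_i$ and $f_\alpha^\beta=f_i^j|_{Y_\alpha}$ whenever $Y_\alpha\subseteq X_i$ and $Y_\beta\subseteq X_j$. A family $\mathcal{F}$ of functions $Y\to Y$ is connected if there is no partition $Y=\coprod_k Y_k$ into at least two non-empty parts with $f(Y_k)\subseteq Y_k$ for all $f\in\mathcal{F}$ and all $k$. *)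

theory Defs
  imports "HOL-Library.FuncSet" "HOL-Library.Disjoint_Sets"
begin

definition right_plonka_magma :: "'a set \<Rightarrow> ('a \<Rightarrow> 'a \<Rightarrow> 'a) \<Rightarrow> bool" where
  "right_plonka_magma X m \<longleftrightarrow>
     (\<forall>x\<in>X. \<forall>y\<in>X. m x y \<in> X) \<and>
     (\<forall>x\<in>X. \<forall>y\<in>X. \<forall>z\<in>X. m (m x y) z = m (m x z) y) \<and>
     (\<forall>x\<in>X. \<forall>y\<in>X. \<forall>z\<in>X. m x (m y z) = m x y)"

text \<open>
  Partitions that differ by a relabelling of the index set are identified, so a family
  \<open>(X\<^sub>i, f\<^sub>i\<^sup>j)\<close> is represented by the set \<open>P\<close> of its parts, with the parts themselves as
  indices: \<open>f A B\<close> is the function \<open>A \<rightarrow> A\<close> attached to the pair of parts \<open>A\<close>, \<open>B\<close>.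
  All functions are extensional (\<open>undefined\<close> off their domain), so that equality of
  these pairs is equality of P{\l}onka partitions.
\<close>

type_synonym 'a plonka_structure = "'a set set \<times> ('a set \<Rightarrow> 'a set \<Rightarrow> 'a \<Rightarrow> 'a)"

fun plonka_partition :: "'a set \<Rightarrow> ('a \<Rightarrow> 'a \<Rightarrow> 'a) \<Rightarrow> 'a plonka_structure \<Rightarrow> bool" where
  "plonka_partition X m (P, f) \<longleftrightarrow>
     partition_on X P \<and>
     f \<in> (\<Pi>\<^sub>E A\<in>P. \<Pi>\<^sub>E B\<in>P. A \<rightarrow>\<^sub>E A) \<and>
     (\<forall>A\<in>P. \<forall>B\<in>P. \<forall>C\<in>P. \<forall>x\<in>A. f A B (f A C x) = f A C (f A B x)) \<and>
     (\<forall>A\<in>P. \<forall>B\<in>P. \<forall>x\<in>A. \<forall>y\<in>B. m x y = f A B x)"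

fun coarser :: "'a plonka_structure \<Rightarrow> 'a plonka_structure \<Rightarrow> bool" (infix "\<preceq>" 50) where
  "(P, f) \<preceq> (Q, g) \<longleftrightarrow>
     (\<forall>B\<in>Q. \<exists>A\<in>P. B \<subseteq> A) \<and>
     (\<forall>B\<in>Q. \<forall>B'\<in>Q. \<forall>A\<in>P. \<forall>A'\<in>P. B \<subseteq> A \<longrightarrow> B' \<subseteq> A' \<longrightarrow> g B B' = restrict (f A A') B)"

definition coarsest_plonka_partition ::
    "'a set \<Rightarrow> ('a \<Rightarrow> 'a \<Rightarrow> 'a) \<Rightarrow> 'a plonka_structure \<Rightarrow> bool" where
  "coarsest_plonka_partition X m \<X> \<longleftrightarrow>
     plonka_partition X m \<X> \<and> (\<forall>\<Y>. plonka_partition X m \<Y> \<longrightarrow> \<X> \<preceq> \<Y>)"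

definition finest_plonka_partition ::
    "'a set \<Rightarrow> ('a \<Rightarrow> 'a \<Rightarrow> 'a) \<Rightarrow> 'a plonka_structure \<Rightarrow> bool" where
  "finest_plonka_partition X m \<X> \<longleftrightarrow>
     plonka_partition X m \<X> \<and> (\<forall>\<Y>. plonka_partition X m \<Y> \<longrightarrow> \<Y> \<preceq> \<X>)"

definition approx_rel :: "'a set \<Rightarrow> ('a \<Rightarrow> 'a \<Rightarrow> 'a) \<Rightarrow> ('a \<times> 'a) set" where
  "approx_rel X m = {(a, b). a \<in> X \<and> b \<in> X \<and> (\<forall>x\<in>X. m x a = m x b)}"

text \<open>
  The value of \<open>f A B\<close> at \<open>x\<close> is \<open>m x b\<close> for any \<open>b \<in> B\<close>. Independence of the chosen \<open>b\<close>
  is part of the assertion that this structure is a P{\l}onka partition.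
\<close>

definition approx_structure :: "'a set \<Rightarrow> ('a \<Rightarrow> 'a \<Rightarrow> 'a) \<Rightarrow> 'a plonka_structure" where
  "approx_structure X m =
     (X // approx_rel X m,
      \<lambda>A\<in>X // approx_rel X m. \<lambda>B\<in>X // approx_rel X m. \<lambda>x\<in>A. m x (SOME b. b \<in> B))"

definition connected_family :: "'a set \<Rightarrow> ('a \<Rightarrow> 'a) set \<Rightarrow> bool" where
  "connected_family Y F \<longleftrightarrow>
     \<not> (\<exists>K. partition_on Y K \<and> (\<exists>A\<in>K. \<exists>B\<in>K. A \<noteq> B) \<and> (\<forall>h\<in>F. \<forall>Z\<in>K. h ` Z \<subseteq> Z))"

fun all_connected :: "'a plonka_structure \<Rightarrow> bool" where
  "all_connected (P, f) \<longleftrightarrow> (\<forall>A\<in>P. connected_family A {f A B | B. B \<in> P})"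

end

theory Submission
  imports Defs
begin

text \<open>
  The maps of a P{\l}onka partition are forced by its parts, and a set partition carries such
  maps iff its equivalence relation lies between the relation generated by \<open>x \<sim> x \<cdot> y\<close> and
  \<open>\<approx>\<close>. Hence P{\l}onka partitions form an interval of the lattice of partitions: the top is the
  partition by \<open>\<approx>\<close>, the bottom is the common refinement of all of them. Splitting a part along a
  disconnection of its family stays in the interval, so the bottom partition has connected
  families; conversely a connected part cannot be cut by the parts of another P{\l}onka
  partition.
\<close>

section \<open>Plonka partitions reduced to their sets of parts\<close>

definition plonka_set_partition :: "'a set \<Rightarrow> ('a \<Rightarrow> 'a \<Rightarrow> 'a) \<Rightarrow> 'a set set \<Rightarrow> bool" where
  "plonka_set_partition X m P \<longleftrightarrow>
     partition_on X P \<and>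
     (\<forall>A\<in>P. \<forall>x\<in>A. \<forall>y\<in>X. m x y \<in> A) \<and>
     (\<forall>B\<in>P. \<forall>b\<in>B. \<forall>b'\<in>B. \<forall>x\<in>X. m x b = m x b')"

text \<open>The same choice and nested restrictions as in \<open>approx_structure\<close>, so that
  the latter is the case \<open>P = X // approx_rel X m\<close> by mere unfolding.\<close>

definition plonka_maps :: "('a \<Rightarrow> 'a \<Rightarrow> 'a) \<Rightarrow> 'a set set \<Rightarrow> 'a set \<Rightarrow> 'a set \<Rightarrow> 'a \<Rightarrow> 'a" where
  "plonka_maps m P = (\<lambda>A\<in>P. \<lambda>B\<in>P. \<lambda>x\<in>A. m x (SOME b. b \<in> B))"

lemma plonka_set_partitionD:
  assumes "plonka_set_partition X m P"
  shows "partition_on X P"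
    and "A \<in> P \<Longrightarrow> x \<in> A \<Longrightarrow> y \<in> X \<Longrightarrow> m x y \<in> A"
    and "B \<in> P \<Longrightarrow> b \<in> B \<Longrightarrow> b' \<in> B \<Longrightarrow> x \<in> X \<Longrightarrow> m x b = m x b'"
  using assms unfolding plonka_set_partition_def by blast+

lemma partition_on_subset: "partition_on X P \<Longrightarrow> A \<in> P \<Longrightarrow> A \<subseteq> X"
  by (auto dest: partition_onD1)

lemma partition_on_nonempty: "partition_on X P \<Longrightarrow> A \<in> P \<Longrightarrow> \<exists>a. a \<in> A"
  by (metis partition_onD3 ex_in_conv)

lemma partition_on_unique: "partition_on X P \<Longrightarrow> A \<in> P \<Longrightarrow> B \<in> P \<Longrightarrow> x \<in> A \<Longrightarrow> x \<in> B \<Longrightarrow> A = B"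
  unfolding partition_on_def disjoint_def by blast

text \<open>All elements of a part act alike from the right, so the choice made by
  \<open>SOME\<close> does not matter.\<close>

lemma plonka_maps_apply:
  assumes P: "plonka_set_partition X m P" and "A \<in> P" "B \<in> P" "x \<in> A" "y \<in> B"
  shows "plonka_maps m P A B x = m x y"
proof -
  have "(SOME b. b \<in> B) \<in> B" using \<open>y \<in> B\<close> by (rule someI)
  moreover have "x \<in> X"
    using partition_on_subset[OF plonka_set_partitionD(1)[OF P]] assms by blast
  ultimately have "m x (SOME b. b \<in> B) = m x y"
    using plonka_set_partitionD(3)[OF P] assms by blast
  then show ?thesis using assms by (simp add: plonka_maps_def)
qed

text \<open>The equation \<open>m x y = f A B x\<close> fixes \<open>f\<close> on its domain because
  parts are non-empty; extensionality fixes it elsewhere. Conversely, commutation of the maps is the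
  law \<open>m (m x y) z = m (m x z) y\<close>.\<close>

lemma plonka_partition_iff:
  assumes X: "right_plonka_magma X m"
  shows "plonka_partition X m (P, f) \<longleftrightarrow> plonka_set_partition X m P \<and> f = plonka_maps m P"
proof
  assume "plonka_partition X m (P, f)"
  then have part: "partition_on X P" and f: "f \<in> (\<Pi>\<^sub>E A\<in>P. \<Pi>\<^sub>E B\<in>P. A \<rightarrow>\<^sub>E A)"
    and mf: "\<And>A B x y. A \<in> P \<Longrightarrow> B \<in> P \<Longrightarrow> x \<in> A \<Longrightarrow> y \<in> B \<Longrightarrow> m x y = f A B x"
    by auto
  have cover: "\<exists>A\<in>P. x \<in> A" if "x \<in> X" for x
    using part that by (auto dest: partition_onD1)
  have P: "plonka_set_partition X m P"
    unfolding plonka_set_partition_def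
  proof (intro conjI ballI)
    fix A x y assume "A \<in> P" "x \<in> A" "y \<in> X"
    moreover obtain B where "B \<in> P" "y \<in> B" using cover \<open>y \<in> X\<close> by blast
    moreover have "f A B \<in> A \<rightarrow>\<^sub>E A" using f \<open>A \<in> P\<close> \<open>B \<in> P\<close> by (meson PiE_mem)
    ultimately show "m x y \<in> A" using mf[of A B x y] by auto
  next
    fix B b b' x assume "B \<in> P" "b \<in> B" "b' \<in> B" "x \<in> X"
    then show "m x b = m x b'" using cover[of x] mf by metis
  qed (rule part)
  have "f A B x = plonka_maps m P A B x" for A B x
  proof (cases "A \<in> P \<and> B \<in> P \<and> x \<in> A")
    case True
    then obtain y where "y \<in> B" using partition_on_nonempty[OF part] by blast
    then show ?thesis using True mf plonka_maps_apply[OF P] by metis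
  next
    case False
    have "f A \<in> (\<Pi>\<^sub>E B\<in>P. A \<rightarrow>\<^sub>E A)" if "A \<in> P" using f that by (rule PiE_mem)
    moreover from this have "f A B \<in> A \<rightarrow>\<^sub>E A" if "A \<in> P" "B \<in> P" using that by (meson PiE_mem)
    \<comment> \<open>If one of \<open>A\<close>, \<open>B\<close>, \<open>x\<close> is out of
      range, both sides fall back on \<open>undefined\<close> at the corresponding level.\<close>
    ultimately show ?thesis
      using False PiE_arb[OF f, of A] PiE_arb[of "f A" P _ B] PiE_arb[of "f A B" A _ x]
      by (auto simp: plonka_maps_def restrict_def)
  qed
  with P show "plonka_set_partition X m P \<and> f = plonka_maps m P" by blast
next
  assume "plonka_set_partition X m P \<and> f = plonka_maps m P"
  then have P: "plonka_set_partition X m P" and f: "f = plonka_maps m P" by auto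
  note part = plonka_set_partitionD(1)[OF P]
  note sub = partition_on_subset[OF part]
  note app = plonka_maps_apply[OF P]
  have mem: "f A B x \<in> A" if "A \<in> P" "B \<in> P" "x \<in> A" for A B x
  proof -
    obtain y where "y \<in> B" using partition_on_nonempty[OF part \<open>B \<in> P\<close>] by blast
    then show ?thesis
      using app[OF that] plonka_set_partitionD(2)[OF P] sub that f by (metis subsetD)
  qed
  have type: "f \<in> (\<Pi>\<^sub>E A\<in>P. \<Pi>\<^sub>E B\<in>P. A \<rightarrow>\<^sub>E A)"
    using mem unfolding f by (auto simp: PiE_iff plonka_maps_def)
  have comm: "f A B (f A C x) = f A C (f A B x)"
    if "A \<in> P" "B \<in> P" "C \<in> P" "x \<in> A" for A B C x
  proof -
    obtain y where y: "y \<in> B" using partition_on_nonempty[OF part \<open>B \<in> P\<close>] by blast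
    obtain z where z: "z \<in> C" using partition_on_nonempty[OF part \<open>C \<in> P\<close>] by blast
    have "f A B w = m w y" "f A C w = m w z" if "w \<in> A" for w
      using app that y z \<open>A \<in> P\<close> \<open>B \<in> P\<close> \<open>C \<in> P\<close> by (simp_all add: f)
    moreover have "m (m x y) z = m (m x z) y"
      using X y z that sub unfolding right_plonka_magma_def by blast
    ultimately show ?thesis using mem that by metis
  qed
  have val: "m x y = f A B x" if "A \<in> P" "B \<in> P" "x \<in> A" "y \<in> B" for A B x y
    using app[OF that] f by simp
  show "plonka_partition X m (P, f)"
    unfolding plonka_partition.simps
    by (intro conjI ballI part type) (rule comm val; assumption)+
qed

text \<open>The condition on maps in \<open>coarser\<close> is automatic: both maps send
  \<open>x\<close> to \<open>m x y\<close> for any \<open>y \<in> B'\<close>, and both are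
  \<open>undefined\<close> outside \<open>B\<close>.\<close>

lemma coarser_iff_refines:
  assumes P: "plonka_set_partition X m P" and Q: "plonka_set_partition X m Q"
  shows "(P, plonka_maps m P) \<preceq> (Q, plonka_maps m Q) \<longleftrightarrow> refines X Q P"
proof -
  have "plonka_maps m Q B B' = restrict (plonka_maps m P A A') B"
    if "B \<in> Q" "B' \<in> Q" "A \<in> P" "A' \<in> P" "B \<subseteq> A" "B' \<subseteq> A'" for A A' B B'
  proof
    fix x
    obtain y where "y \<in> B'"
      using partition_on_nonempty[OF plonka_set_partitionD(1)[OF Q] \<open>B' \<in> Q\<close>] by blast
    then show "plonka_maps m Q B B' x = restrict (plonka_maps m P A A') B x"
      using that plonka_maps_apply[OF P, of A A' x y] plonka_maps_apply[OF Q, of B B' x y]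
      by (cases "x \<in> B") (force, simp add: plonka_maps_def[of m Q])
  qed
  then show ?thesis
    using plonka_set_partitionD(1)[OF P] plonka_set_partitionD(1)[OF Q]
    by (auto simp: refines_def)
qed

section \<open>The top of the interval: the classes of \<open>approx_rel\<close>\<close>

lemma equiv_approx_rel: "equiv X (approx_rel X m)"
  by (rule equivI) (auto simp: approx_rel_def refl_on_def sym_def trans_def)

text \<open>The law \<open>m x (m y z) = m x y\<close> says that \<open>y\<close> and
  \<open>m y z\<close> are equivalent, so classes are closed under right multiplication.\<close>

lemma plonka_set_partition_approx:
  assumes "right_plonka_magma X m"
  shows "plonka_set_partition X m (X // approx_rel X m)"
  unfolding plonka_set_partition_def
proof (intro conjI ballI)
  show "partition_on X (X // approx_rel X m)"
    by (rule partition_on_quotient[OF equiv_approx_rel])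
next
  fix A x y assume A: "A \<in> X // approx_rel X m" "x \<in> A" "y \<in> X"
  then have "x \<in> X" using in_quotient_imp_subset[OF equiv_approx_rel] by blast
  then have "(x, m x y) \<in> approx_rel X m"
    using assms \<open>y \<in> X\<close> by (auto simp: approx_rel_def right_plonka_magma_def)
  then show "m x y \<in> A" using in_quotient_imp_closed[OF equiv_approx_rel] A by metis
next
  fix B b b' x assume "B \<in> X // approx_rel X m" "b \<in> B" "b' \<in> B" "x \<in> X"
  then show "m x b = m x b'"
    using in_quotient_imp_in_rel[OF equiv_approx_rel, of B X m b b'] by (auto simp: approx_rel_def)
qed

lemma refines_approx:
  assumes P: "plonka_set_partition X m P" and X: "right_plonka_magma X m"
  shows "refines X P (X // approx_rel X m)"
  unfolding refines_def
proof (intro conjI ballI)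
  fix A assume A: "A \<in> P"
  note part = plonka_set_partitionD(1)[OF P]
  obtain a where a: "a \<in> A" using partition_on_nonempty[OF part A] by blast
  have "A \<subseteq> X" using partition_on_subset[OF part A] .
  have "(a, b) \<in> approx_rel X m" if "b \<in> A" for b
    using a that \<open>A \<subseteq> X\<close> plonka_set_partitionD(3)[OF P A a that]
    unfolding approx_rel_def by blast
  then have "A \<subseteq> approx_rel X m `` {a}" by blast
  moreover have "approx_rel X m `` {a} \<in> X // approx_rel X m"
    using a \<open>A \<subseteq> X\<close> by (blast intro: quotientI)
  ultimately show "\<exists>Y\<in>X // approx_rel X m. A \<subseteq> Y" by blast
qed (use plonka_set_partitionD(1)[OF P] plonka_set_partitionD(1)[OF plonka_set_partition_approx[OF X]]
  in blast)+

section \<open>The bottom of the interval: the common refinement\<close>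

text \<open>Closure under right multiplication passes to intersections, and equal right action
  passes to subsets.\<close>

lemma plonka_set_partition_common_refinement:
  assumes X: "right_plonka_magma X m"
  shows "plonka_set_partition X m (common_refinement {P. plonka_set_partition X m P})"
    (is "plonka_set_partition X m (common_refinement ?S)")
proof -
  have approx: "plonka_set_partition X m (X // approx_rel X m)"
    by (rule plonka_set_partition_approx[OF X])
  \<comment> \<open>The quotient by \<open>approx_rel\<close> also witnesses that \<open>?S\<close>
    is non-empty.\<close>
  have part: "partition_on X (common_refinement ?S)"
    using approx by (intro partition_on_common_refinement) (auto dest: plonka_set_partitionD(1))
  have closed: "m x y \<in> A" if A: "A \<in> common_refinement ?S" "x \<in> A" "y \<in> X" for A x y
  proof -
    \<comment> \<open>\<open>h\<close> picks one part from each partition in \<open>?S\<close>;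
      \<open>A\<close> is the intersection of the picks.\<close>
    obtain h where h: "h \<in> (\<Pi>\<^sub>E P\<in>?S. P)" and Ah: "A = (\<Inter>P\<in>?S. h P)"
      using A(1) by (auto simp: common_refinement_def)
    have "m x y \<in> h P" if P: "P \<in> ?S" for P
      using P PiE_mem[OF h P] A unfolding Ah by (blast intro: plonka_set_partitionD(2))
    then show ?thesis unfolding Ah by blast
  qed
  have const: "m x b = m x b'"
    if A: "A \<in> common_refinement ?S" "b \<in> A" "b' \<in> A" "x \<in> X" for A b b' x
  proof -
    obtain B where "B \<in> X // approx_rel X m" "A \<subseteq> B"
      using common_refinement_exists[OF A(1)] approx by blast
    then show ?thesis using plonka_set_partitionD(3)[OF approx] A by blast
  qed
  show ?thesis
    using part closed const by (subst plonka_set_partition_def) blast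
qed

section \<open>Connectedness and minimality\<close>

text \<open>Since the parts \<open>B\<close> cover \<open>X\<close>, stability under every map
  \<open>plonka_maps m P A B\<close> amounts to closure under right multiplication by all of
  \<open>X\<close>.\<close>

lemma connected_family_plonka_maps_iff:
  assumes P: "plonka_set_partition X m P" and A: "A \<in> P"
  shows "connected_family A {plonka_maps m P A B | B. B \<in> P} \<longleftrightarrow>
    (\<forall>K. partition_on A K \<longrightarrow> (\<forall>Z\<in>K. \<forall>x\<in>Z. \<forall>y\<in>X. m x y \<in> Z) \<longrightarrow> K = {A})"
proof -
  note part = plonka_set_partitionD(1)[OF P]
  have closed: "(\<forall>h\<in>{plonka_maps m P A B | B. B \<in> P}. \<forall>Z\<in>K. h ` Z \<subseteq> Z) \<longleftrightarrow>
      (\<forall>Z\<in>K. \<forall>x\<in>Z. \<forall>y\<in>X. m x y \<in> Z)" (is "?L \<longleftrightarrow> ?R")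
    if K: "partition_on A K" for K
  proof
    assume L: ?L
    show ?R
    proof (intro ballI)
      fix Z x y assume "Z \<in> K" "x \<in> Z" "y \<in> X"
      moreover obtain B where "B \<in> P" "y \<in> B" using part \<open>y \<in> X\<close> by (auto dest: partition_onD1)
      moreover have "x \<in> A" using partition_on_subset[OF K] \<open>Z \<in> K\<close> \<open>x \<in> Z\<close> by blast
      moreover have "plonka_maps m P A B x \<in> Z" using L \<open>Z \<in> K\<close> \<open>x \<in> Z\<close> \<open>B \<in> P\<close> by blast
      ultimately show "m x y \<in> Z" using plonka_maps_apply[OF P A] by metis
    qed
  next
    assume R: ?R
    show ?L
    proof (intro ballI subsetI)
      fix h Z w assume "h \<in> {plonka_maps m P A B | B. B \<in> P}" "Z \<in> K" "w \<in> h ` Z"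
      then obtain B x where Bx: "B \<in> P" "x \<in> Z" "w = plonka_maps m P A B x" by blast
      obtain y where "y \<in> B" using partition_on_nonempty[OF part] Bx by blast
      moreover have "x \<in> A" using partition_on_subset[OF K] \<open>Z \<in> K\<close> Bx by blast
      moreover have "y \<in> X" using partition_on_subset[OF part] Bx \<open>y \<in> B\<close> by blast
      ultimately show "w \<in> Z" using plonka_maps_apply[OF P A] R \<open>Z \<in> K\<close> Bx by metis
    qed
  qed
  have trivial: "(\<exists>B\<in>K. \<exists>C\<in>K. B \<noteq> C) \<longleftrightarrow> K \<noteq> {A}" if K: "partition_on A K" for K
  proof
    assume "K \<noteq> {A}"
    \<comment> \<open>Non-emptiness of \<open>A\<close> excludes \<open>K = {}\<close>, which would
      differ from \<open>{A}\<close> without having two parts.\<close>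
    obtain a where "a \<in> A" using partition_on_nonempty[OF part A] by blast
    then have "K \<noteq> {}" using partition_onD1[OF K] by blast
    show "\<exists>B\<in>K. \<exists>C\<in>K. B \<noteq> C"
    proof (rule ccontr)
      assume "\<not> ?thesis"
      with \<open>K \<noteq> {}\<close> obtain B where "K = {B}" by blast
      with \<open>K \<noteq> {A}\<close> partition_onD1[OF K] show False by simp
    qed
  qed auto
  show ?thesis
    \<comment> \<open>\<open>conj_cong\<close> supplies \<open>partition_on A K\<close>, the premise
      of both rewrite rules.\<close>
    unfolding connected_family_def by (simp only: closed trivial cong: conj_cong) blast
qed

text \<open>Each new part lies inside an old one, hence its elements still act alike; closure of the
  pieces of \<open>A\<close> is assumed.\<close>

lemma plonka_set_partition_split:
  assumes P: "plonka_set_partition X m P" and A: "A \<in> P" and K: "partition_on A K"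
    and closed: "\<And>Z x y. Z \<in> K \<Longrightarrow> x \<in> Z \<Longrightarrow> y \<in> X \<Longrightarrow> m x y \<in> Z"
  shows "plonka_set_partition X m ((P - {A}) \<union> K)"
  unfolding plonka_set_partition_def
proof (intro conjI)
  note part = plonka_set_partitionD(1)[OF P]
  note disj = partition_on_unique[OF part] and disjK = partition_on_unique[OF K]
  have KA: "Z \<subseteq> A" if "Z \<in> K" for Z using partition_on_subset[OF K that] .
  show "partition_on X ((P - {A}) \<union> K)"
  proof (rule partition_onI)
    have "\<Union>P = X" "\<Union>K = A" using partition_onD1[OF part] partition_onD1[OF K] by auto
    then show "\<Union>((P - {A}) \<union> K) = X" using A by blast
    show "{} \<notin> (P - {A}) \<union> K" using partition_onD3[OF part] partition_onD3[OF K] by blast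
    show "disjnt B C" if "B \<in> (P - {A}) \<union> K" "C \<in> (P - {A}) \<union> K" "B \<noteq> C" for B C
    proof -
      have *: "disjnt B C" if "B \<in> P - {A}" "C \<in> K" for B C
        using disj[of B A] KA[OF \<open>C \<in> K\<close>] that A by (auto simp: disjnt_iff)
      show ?thesis
        using that *[of B C] *[of C B] disj[of B C] disjK[of B C] by (auto simp: disjnt_iff)
    qed
  qed
  show "\<forall>B\<in>(P - {A}) \<union> K. \<forall>x\<in>B. \<forall>y\<in>X. m x y \<in> B"
    using plonka_set_partitionD(2)[OF P] closed by blast
  have "\<exists>B'\<in>P. B \<subseteq> B'" if "B \<in> (P - {A}) \<union> K" for B using that KA A by blast
  then show "\<forall>B\<in>(P - {A}) \<union> K. \<forall>b\<in>B. \<forall>b'\<in>B. \<forall>x\<in>X. m x b = m x b'"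
    using plonka_set_partitionD(3)[OF P] by (meson subsetD)
qed

lemma all_connected_iff_finest:
  assumes P: "plonka_set_partition X m P"
  shows "all_connected (P, plonka_maps m P) \<longleftrightarrow>
    (\<forall>Q. plonka_set_partition X m Q \<longrightarrow> refines X P Q)"
proof
  note part = plonka_set_partitionD(1)[OF P]
  assume conn: "all_connected (P, plonka_maps m P)"
  show "\<forall>Q. plonka_set_partition X m Q \<longrightarrow> refines X P Q"
  proof (intro allI impI)
    fix Q assume Q: "plonka_set_partition X m Q"
    note partQ = plonka_set_partitionD(1)[OF Q]
    have "\<exists>C\<in>Q. A \<subseteq> C" if A: "A \<in> P" for A
    proof -
      have AX: "A \<subseteq> X" using partition_on_subset[OF part A] .
      \<comment> \<open>The non-empty traces on \<open>A\<close> of the parts of \<open>Q\<close>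
        are closed under right multiplication. By connectedness there is only the trace
        \<open>A\<close> itself, so \<open>A\<close> lies in a single part of
        \<open>Q\<close>.\<close>
      let ?K = "(\<inter>) A ` Q - {{}}"
      have "partition_on (A \<inter> X) ?K" using partition_on_restrict[OF partQ, of A] .
      then have "partition_on A ?K" using AX by (simp add: Int_absorb2)
      moreover have "\<forall>Z\<in>?K. \<forall>x\<in>Z. \<forall>y\<in>X. m x y \<in> Z"
        using plonka_set_partitionD(2)[OF P A] plonka_set_partitionD(2)[OF Q] by blast
      moreover have "connected_family A {plonka_maps m P A B | B. B \<in> P}"
        using conn A by simp
      ultimately have "?K = {A}"
        unfolding connected_family_plonka_maps_iff[OF P A] by iprover
      then have "A \<in> ?K" by (simp only: singletonI)
      then show ?thesis by blast
    qed
    then show "refines X P Q" unfolding refines_def using part partQ by blast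
  qed
next
  note part = plonka_set_partitionD(1)[OF P]
  assume fin: "\<forall>Q. plonka_set_partition X m Q \<longrightarrow> refines X P Q"
  have "K = {A}" if A: "A \<in> P" and K: "partition_on A K"
    and closed: "\<forall>Z\<in>K. \<forall>x\<in>Z. \<forall>y\<in>X. m x y \<in> Z" for A K
  proof -
    have "plonka_set_partition X m ((P - {A}) \<union> K)"
      using closed by (intro plonka_set_partition_split[OF P A K]) auto
    then have "refines X P ((P - {A}) \<union> K)" using fin by iprover
    then obtain C where C: "C \<in> (P - {A}) \<union> K" "A \<subseteq> C"
      using A unfolding refines_def by meson
    obtain a where a: "a \<in> A" using partition_on_nonempty[OF part A] by blast
    \<comment> \<open>A part in \<open>P - {A}\<close> cannot contain \<open>a\<close>, so
      \<open>C\<close> is a piece of \<open>A\<close>; containing \<open>A\<close>, it equals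
      \<open>A\<close>. Every other piece is non-empty and meets \<open>A\<close>, so
      \<open>K\<close> is trivial.\<close>
    then have "C \<in> K" using C partition_on_unique[OF part A] by blast
    then have "A \<in> K" using C(2) partition_on_subset[OF K, of C] by (metis subset_antisym)
    moreover have "B = A" if "B \<in> K" for B
      using partition_on_nonempty[OF K that] partition_on_subset[OF K that]
        partition_on_unique[OF K that \<open>A \<in> K\<close>] by blast
    ultimately show "K = {A}" by blast
  qed
  then show "all_connected (P, plonka_maps m P)"
    by (simp add: connected_family_plonka_maps_iff[OF P])
qed

theorem theorem3p18:
  fixes X :: "'a set" and m :: "'a \<Rightarrow> 'a \<Rightarrow> 'a"
  assumes "right_plonka_magma X m"
  shows "(coarsest_plonka_partition X m (approx_structure X m) \<and>
          (\<forall>\<X>. coarsest_plonka_partition X m \<X> \<longrightarrow> \<X> = approx_structure X m)) \<and>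
         ((\<exists>!\<X>. finest_plonka_partition X m \<X>) \<and>
          (\<forall>\<X>. finest_plonka_partition X m \<X> \<longleftrightarrow> plonka_partition X m \<X> \<and> all_connected \<X>))"
proof -
  let ?A = "X // approx_rel X m" and ?S = "{P. plonka_set_partition X m P}"
  note iff = plonka_partition_iff[OF assms]
  \<comment> \<open>With the maps eliminated, both extremality notions become statements about
    \<open>refines\<close> alone, and uniqueness follows from its antisymmetry.\<close>
  have coarsest: "coarsest_plonka_partition X m (P, f) \<longleftrightarrow>
      plonka_set_partition X m P \<and> f = plonka_maps m P \<and>
      (\<forall>Q. plonka_set_partition X m Q \<longrightarrow> refines X Q P)" for P f
    unfolding coarsest_plonka_partition_def split_paired_All iff using coarser_iff_refines by blast
  have finest: "finest_plonka_partition X m (P, f) \<longleftrightarrow>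
      plonka_set_partition X m P \<and> f = plonka_maps m P \<and>
      (\<forall>Q. plonka_set_partition X m Q \<longrightarrow> refines X P Q)" for P f
    unfolding finest_plonka_partition_def split_paired_All iff using coarser_iff_refines by blast
  have approx: "approx_structure X m = (?A, plonka_maps m ?A)"
    by (simp add: approx_structure_def plonka_maps_def)
  have A: "plonka_set_partition X m ?A" using plonka_set_partition_approx[OF assms] .
  have "coarsest_plonka_partition X m (approx_structure X m)"
    unfolding approx coarsest using A refines_approx assms by blast
  moreover have "\<forall>\<X>. coarsest_plonka_partition X m \<X> \<longrightarrow> \<X> = approx_structure X m"
    unfolding approx split_paired_All coarsest
    using A refines_approx[OF _ assms] refines_asym by blast
  moreover have "finest_plonka_partition X m (common_refinement ?S, plonka_maps m (common_refinement ?S))"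
    unfolding finest using plonka_set_partition_common_refinement[OF assms]
    by (auto intro!: refines_common_refinement dest: plonka_set_partitionD(1))
  moreover have "\<X> = \<Y>" if "finest_plonka_partition X m \<X>" "finest_plonka_partition X m \<Y>" for \<X> \<Y>
  proof -
    obtain P f Q g where "\<X> = (P, f)" "\<Y> = (Q, g)" by fastforce
    with that show ?thesis using refines_asym[of X P Q] by (simp add: finest)
  qed
  \<comment> \<open>Connectedness of the common refinement is never checked directly; it follows
    from its minimality.\<close>
  moreover have "\<forall>\<X>. finest_plonka_partition X m \<X> \<longleftrightarrow> plonka_partition X m \<X> \<and> all_connected \<X>"
    unfolding split_paired_All finest iff using all_connected_iff_finest by blast
  ultimately show ?thesis by blast
qed

end
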